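(* Let $p$ be a prime and $S$ a finite $p$-group. Then $$I_{\mathrm{lex}}(S)=Z(J_{\mathrm{lex}}(S))=C_S(J_{\mathrm{lex}}(S))\geq Z(J_r(S))$$ and $$I_{\mathrm{olex}}(S)=Z(J_{\mathrm{olex}}(S))=C_S(J_{\mathrm{olex}}(S))\geq Z(J_o(S)).$$
   Context: All groups are finite. $\mathfrak{Ab}(S)$ is the set of abelian subgroups of $S$. The rank of an abelian group is the size of its smallest generating set; the rank of a nonabelian $p$-group is the maximum of the ranks of its abelian subgroups. For an abelian $p$-group $A$, $\Omega_i(A)$ is the subgroup generated by all elements of order $\leq p^i$ and $\omega_i(A):=|\Omega_i(A)|$. For abelian $p$-groups $A,A'$, $A\geq_{\mathrm{lex}}A'$ means that the sequence $(\omega_1(A),\omega_2(A),\dots)$ is greater than or equal to $(\omega_1(A'),\omega_2(A'),\dots)$ in the usual lexicographic order. Define: $\mathcal{A}_o(S)=\{A\in\mathfrak{Ab}(S): |A|\geq|A'|\text{ for all }A'\in\mathfrak{Ab}(S)\}$; $\mathcal{A}_r(S)=\{A\in\mathfrak{Ab}(S): \mathrm{rank}(A)=\mathrm{rank}(S)\}$; $\mathcal{A}_{\mathrm{lex}}(S)=\{A\in\mathfrak{Ab}(S): A\geq_{\mathrm{lex}}A'\text{ for all }A'\in\mathfrak{Ab}(S)\}$; $\mathcal{A}_{\mathrm{olex}}(S)=\{A\in\mathcal{A}_o(S): A\geq_{\mathrm{lex}}A'\text{ for all }A'\in\mathcal{A}_o(S)\}$. For each subscript, $J_{\cdots}(S)$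 denotes the subgroup generated by all members of $\mathcal{A}_{\cdots}(S)$ and $I_{\cdots}(S)$ the intersection of all members of $\mathcal{A}_{\cdots}(S)$. $Z(\cdot)$ denotes the center. *)

theory Defs
  imports "HOL-Algebra.Algebra" "HOL-Library.Fun_Lexorder"
begin

(* Subgroups are represented by their carrier sets, as in HOL-Algebra; the group structure
   on a subgroup A of G is G\<lparr>carrier := A\<rparr>. *)

definition abelian_subgroups :: "('a, 'b) monoid_scheme \<Rightarrow> 'a set set" where
  "abelian_subgroups G = {A. subgroup A G \<and> comm_group (G\<lparr>carrier := A\<rparr>)}"

definition centralizer :: "('a, 'b) monoid_scheme \<Rightarrow> 'a set \<Rightarrow> 'a set" where
  "centralizer G H = {g \<in> carrier G. \<forall>h\<in>H. g \<otimes>\<^bsub>G\<^esub> h = h \<otimes>\<^bsub>G\<^esub> g}"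

definition center :: "('a, 'b) monoid_scheme \<Rightarrow> 'a set" where
  "center G = {z \<in> carrier G. \<forall>x\<in>carrier G. z \<otimes>\<^bsub>G\<^esub> x = x \<otimes>\<^bsub>G\<^esub> z}"

definition min_generators :: "('a, 'b) monoid_scheme \<Rightarrow> nat" where
  "min_generators G =
     (LEAST n. \<exists>B. B \<subseteq> carrier G \<and> finite B \<and> card B = n \<and> generate G B = carrier G)"

definition group_rank :: "('a, 'b) monoid_scheme \<Rightarrow> nat" where
  "group_rank G =
     (if comm_group G then min_generators G
      else Max ((\<lambda>A. min_generators (G\<lparr>carrier := A\<rparr>)) ` abelian_subgroups G))"

definition Omega_sub :: "nat \<Rightarrow> nat \<Rightarrow> ('a, 'b) monoid_scheme \<Rightarrow> 'a set" where
  "Omega_sub p i A = generate A {x \<in> carrier A. group.ord A x \<le> p ^ i}"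

definition omega :: "nat \<Rightarrow> nat \<Rightarrow> ('a, 'b) monoid_scheme \<Rightarrow> nat" where
  "omega p i A = card (Omega_sub p i A)"

(* The sequences being compared start at i = 1; less_fun is the strict lexicographic order. *)
definition lex_ge ::
  "nat \<Rightarrow> ('a, 'b) monoid_scheme \<Rightarrow> ('c, 'd) monoid_scheme \<Rightarrow> bool" where
  "lex_ge p A A' \<longleftrightarrow>
     (\<lambda>i. omega p (Suc i) A') = (\<lambda>i. omega p (Suc i) A) \<or>
     less_fun (\<lambda>i. omega p (Suc i) A') (\<lambda>i. omega p (Suc i) A)"

definition A_o :: "('a, 'b) monoid_scheme \<Rightarrow> 'a set set" where
  "A_o S = {A \<in> abelian_subgroups S. \<forall>A' \<in> abelian_subgroups S. card A \<ge> card A'}"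

definition A_r :: "('a, 'b) monoid_scheme \<Rightarrow> 'a set set" where
  "A_r S = {A \<in> abelian_subgroups S. group_rank (S\<lparr>carrier := A\<rparr>) = group_rank S}"

definition A_lex :: "nat \<Rightarrow> ('a, 'b) monoid_scheme \<Rightarrow> 'a set set" where
  "A_lex p S = {A \<in> abelian_subgroups S.
     \<forall>A' \<in> abelian_subgroups S. lex_ge p (S\<lparr>carrier := A\<rparr>) (S\<lparr>carrier := A'\<rparr>)}"

definition A_olex :: "nat \<Rightarrow> ('a, 'b) monoid_scheme \<Rightarrow> 'a set set" where
  "A_olex p S = {A \<in> A_o S.
     \<forall>A' \<in> A_o S. lex_ge p (S\<lparr>carrier := A\<rparr>) (S\<lparr>carrier := A'\<rparr>)}"

definition J_o :: "('a, 'b) monoid_scheme \<Rightarrow> 'a set" where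
  "J_o S = generate S (\<Union> (A_o S))"

definition J_r :: "('a, 'b) monoid_scheme \<Rightarrow> 'a set" where
  "J_r S = generate S (\<Union> (A_r S))"

definition J_lex :: "nat \<Rightarrow> ('a, 'b) monoid_scheme \<Rightarrow> 'a set" where
  "J_lex p S = generate S (\<Union> (A_lex p S))"

definition J_olex :: "nat \<Rightarrow> ('a, 'b) monoid_scheme \<Rightarrow> 'a set" where
  "J_olex p S = generate S (\<Union> (A_olex p S))"

(* For a finite p-group S the intersected families are nonempty. *)
definition I_lex :: "nat \<Rightarrow> ('a, 'b) monoid_scheme \<Rightarrow> 'a set" where
  "I_lex p S = \<Inter> (A_lex p S)"

definition I_olex :: "nat \<Rightarrow> ('a, 'b) monoid_scheme \<Rightarrow> 'a set" where
  "I_olex p S = \<Inter> (A_olex p S)"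

end

theory Submission
  imports Defs
begin

text \<open>
  If \<open>x\<close> centralizes an abelian subgroup \<open>A\<close>, then \<open>A\<close> and \<open>x\<close> generate an abelian subgroup, so
  an abelian subgroup that is maximal with respect to the order, or lexicographically, contains its
  centralizer. For any nonempty family of self-centralizing abelian subgroups, the
  intersection of the family is the centralizer of the subgroup \<open>J\<close> it generates, and as it lies
  in \<open>J\<close> it is also the center of \<open>J\<close>. The inclusion for \<open>J\<^sub>r\<close> holds because
  lexicographically maximal subgroups have maximal rank: a finite abelian \<open>p\<close>-group \<open>A\<close> satisfies
  \<open>|\<Omega>\<^sub>1(A)| = |A/A\<^sup>p| = p\<^sup>d\<close>, where \<open>d\<close> is the minimal number of generators.
\<close>

section \<open>Lexicographic comparison of omega sequences\<close>

lemma less_fun_or_eq_total: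
  fixes f g :: "nat \<Rightarrow> 'c::linorder"
  shows "f = g \<or> less_fun f g \<or> less_fun g f"
proof (rule disjCI)
  assume "\<not> (less_fun f g \<or> less_fun g f)"
  show "f = g"
  proof
    fix k
    show "f k = g k"
    \<comment> \<open>If all earlier entries agree, a disagreement at \<open>k\<close> would be the
      first one and would decide the order.\<close>
    proof (induction k rule: less_induct)
      case (less k)
      then show ?case
        using \<open>\<not> (less_fun f g \<or> less_fun g f)\<close> unfolding less_fun_def
        by (metis linorder_neq_iff)
    qed
  qed
qed

lemma lex_ge_refl: "lex_ge p A A"
  by (simp add: lex_ge_def)

lemma lex_ge_total: "lex_ge p A B \<or> lex_ge p B A"
  using less_fun_or_eq_total[of "\<lambda>i. omega p (Suc i) A" "\<lambda>i. omega p (Suc i) B"]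
  unfolding lex_ge_def by auto

lemma lex_ge_trans: "lex_ge p A B \<Longrightarrow> lex_ge p B C \<Longrightarrow> lex_ge p A C"
  unfolding lex_ge_def by (auto dest: less_fun_trans)

text \<open>The compared sequences start at index \<open>Suc 0\<close>: either they first differ
  there, with the right sign, or they agree there. This is the link from lexicographic maximality to
  rank.\<close>

lemma lex_ge_omega1:
  assumes "lex_ge p A B"
  shows "omega p 1 B \<le> omega p 1 A"
  using assms unfolding lex_ge_def
proof
  assume "(\<lambda>i. omega p (Suc i) B) = (\<lambda>i. omega p (Suc i) A)"
  from fun_cong[OF this, of 0] show ?thesis by simp
next
  assume "less_fun (\<lambda>i. omega p (Suc i) B) (\<lambda>i. omega p (Suc i) A)"
  then obtain k where "omega p (Suc k) B < omega p (Suc k) A"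
      "\<And>j. j < k \<Longrightarrow> omega p (Suc j) B = omega p (Suc j) A"
    by (rule less_funE) blast
  then show ?thesis by (cases k) force+
qed

text \<open>A strict lexicographic inequality needs some entry of \<open>B\<close> below that of
  \<open>A\<close>, which dominance excludes. It is applied to subgroups \<open>A\<close>
  \<subseteq> \<open>B\<close> with \<open>A\<close> lexicographically maximal.\<close>

lemma lex_ge_dominated_imp_eq:
  assumes "lex_ge p A B" and le: "\<And>i. omega p (Suc i) A \<le> omega p (Suc i) B"
  shows "omega p (Suc i) A = omega p (Suc i) B"
proof -
  have "\<not> less_fun (\<lambda>i. omega p (Suc i) B) (\<lambda>i. omega p (Suc i) A)"
    using le by (auto simp: less_fun_def linorder_not_less)
  then have "(\<lambda>i. omega p (Suc i) B) = (\<lambda>i. omega p (Suc i) A)"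
    using assms(1) by (simp add: lex_ge_def)
  from fun_cong[OF this, of i] show ?thesis by simp
qed

text \<open>Distinct groups can share an omega sequence, so \<open>lex_ge\<close> is a total
  preorder rather than a linear order; the maximum is built by induction on the family.\<close>

lemma ex_lex_maximal:
  assumes "finite F" "F \<noteq> {}"
  shows "\<exists>A\<in>F. \<forall>B\<in>F. lex_ge p (G A) (G B)"
  using assms
proof (induction F rule: finite_ne_induct)
  case (singleton A)
  then show ?case by (simp add: lex_ge_refl)
next
  case (insert A F)
  then obtain M where "M \<in> F" "\<forall>B\<in>F. lex_ge p (G M) (G B)" by blast
  then show ?case
    using lex_ge_total[of p "G A" "G M"] lex_ge_trans lex_ge_refl by (metis insert_iff)
qed

section \<open>Centralizers, abelian subgroups and families of self-centralizing subgroups\<close>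

context group
begin

lemma centralizer_is_subgroup:
  assumes "U \<subseteq> carrier G"
  shows "subgroup (centralizer G U) G"
proof (rule subgroupI)
  show "centralizer G U \<subseteq> carrier G" by (auto simp: centralizer_def)
  have "\<one> \<in> centralizer G U" using assms by (auto simp: centralizer_def)
  then show "centralizer G U \<noteq> {}" by blast
next
  fix a assume a: "a \<in> centralizer G U"
  have "inv a \<otimes> h = h \<otimes> inv a" if "h \<in> U" for h
  proof -
    have "h \<in> carrier G" "a \<in> carrier G" "a \<otimes> h = h \<otimes> a"
      using a that assms by (auto simp: centralizer_def)
    then show ?thesis by (metis inv_closed inv_solve_left inv_solve_right m_assoc m_closed)
  qed
  then show "inv a \<in> centralizer G U" using a by (auto simp: centralizer_def)
next
  fix a b assume ab: "a \<in> centralizer G U" "b \<in> centralizer G U"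
  have "a \<otimes> b \<otimes> h = h \<otimes> (a \<otimes> b)" if "h \<in> U" for h
  proof -
    have "h \<in> carrier G" "a \<in> carrier G" "b \<in> carrier G" "a \<otimes> h = h \<otimes> a" "b \<otimes> h = h \<otimes> b"
      using ab that assms by (auto simp: centralizer_def)
    then show ?thesis by (metis m_assoc)
  qed
  then show "a \<otimes> b \<in> centralizer G U" using ab by (auto simp: centralizer_def)
qed

text \<open>Commuting is symmetric, so \<open>centralizer G\<close> forms an antitone Galois
  connection with itself.\<close>

lemma subset_centralizer_swap:
  assumes "U \<subseteq> carrier G" "Y \<subseteq> carrier G"
  shows "U \<subseteq> centralizer G Y \<longleftrightarrow> Y \<subseteq> centralizer G U"
  using assms by (fastforce simp: centralizer_def)

lemma centralizer_generate:
  assumes "U \<subseteq> carrier G"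
  shows "centralizer G (generate G U) = centralizer G U"
proof
  show "centralizer G (generate G U) \<subseteq> centralizer G U"
    by (auto simp: centralizer_def generate.incl)
  have C: "centralizer G U \<subseteq> carrier G" by (auto simp: centralizer_def)
  \<comment> \<open>The double centralizer contains \<open>U\<close> and is a subgroup, so it
    absorbs \<open>generate G U\<close>; swapping back gives the inclusion.\<close>
  then have "U \<subseteq> centralizer G (centralizer G U)"
    using subset_centralizer_swap[OF assms] by blast
  then have "generate G U \<subseteq> centralizer G (centralizer G U)"
    by (rule generate_subgroup_incl) (rule centralizer_is_subgroup[OF C])
  then show "centralizer G U \<subseteq> centralizer G (generate G U)"
    using subset_centralizer_swap[OF C generate_incl[OF assms]] by blast
qed

text \<open>Turns commutativity of the restricted structure into an inclusion to which the Galois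
  connection applies.\<close>

lemma abelian_subgroups_iff:
  "A \<in> abelian_subgroups G \<longleftrightarrow> subgroup A G \<and> A \<subseteq> centralizer G A"
proof -
  have "comm_group (G\<lparr>carrier := A\<rparr>) \<longleftrightarrow> A \<subseteq> centralizer G A" if A: "subgroup A G"
  proof
    assume "comm_group (G\<lparr>carrier := A\<rparr>)"
    then show "A \<subseteq> centralizer G A"
      using subgroup.subset[OF A] comm_groupE(4)[of "G\<lparr>carrier := A\<rparr>"]
      by (auto simp: centralizer_def)
  next
    assume "A \<subseteq> centralizer G A"
    then show "comm_group (G\<lparr>carrier := A\<rparr>)"
      by (intro group.group_comm_groupI[OF subgroup_imp_group[OF A]])
        (auto simp: centralizer_def)
  qed
  then show ?thesis by (auto simp: abelian_subgroups_def)
qed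

lemma abelian_subgroups_subset: "A \<in> abelian_subgroups G \<Longrightarrow> A \<subseteq> carrier G"
  by (simp add: abelian_subgroups_iff subgroup.subset)

lemma insert_centralizing_abelian:
  assumes A: "A \<in> abelian_subgroups G" and x: "x \<in> centralizer G A"
  shows "generate G (insert x A) \<in> abelian_subgroups G"
proof -
  have sub: "insert x A \<subseteq> carrier G"
    using A x by (auto simp: abelian_subgroups_iff centralizer_def)
  \<comment> \<open>Commutativity is checked on the generators only;
    \<open>centralizer_generate\<close> carries it to the subgroup they generate.\<close>
  have "insert x A \<subseteq> centralizer G (insert x A)"
    using A x sub by (auto simp: abelian_subgroups_iff centralizer_def)
  then have "generate G (insert x A) \<subseteq> centralizer G (insert x A)"
    by (rule generate_subgroup_incl) (rule centralizer_is_subgroup[OF sub])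
  then show ?thesis
    using generate_is_subgroup[OF sub] centralizer_generate[OF sub]
    by (simp add: abelian_subgroups_iff)
qed

lemma maximal_abelian_self_centralizing:
  assumes "A \<in> abelian_subgroups G"
    and "\<And>B. B \<in> abelian_subgroups G \<Longrightarrow> A \<subseteq> B \<Longrightarrow> B = A"
  shows "centralizer G A \<subseteq> A"
proof
  fix x assume "x \<in> centralizer G A"
  then have "generate G (insert x A) = A"
    using insert_centralizing_abelian assms generate.incl[of _ "insert x A" G] by blast
  then show "x \<in> A" using generate.incl[of x "insert x A" G] by auto
qed

lemma center_subgroup_eq:
  assumes "H \<subseteq> carrier G"
  shows "center (G\<lparr>carrier := H\<rparr>) = H \<inter> centralizer G H"
  using assms by (auto simp: center_def centralizer_def)

text \<open>Source of both final inclusions, with \<open>K\<close> the larger of two nested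
  J-subgroups.\<close>

lemma center_antimono_centralizer:
  assumes "H \<subseteq> K" "K \<subseteq> carrier G"
  shows "center (G\<lparr>carrier := K\<rparr>) \<subseteq> centralizer G H"
  using assms by (auto simp: center_def centralizer_def)

lemma Inter_self_centralizing_family:
  assumes F: "F \<subseteq> abelian_subgroups G" "F \<noteq> {}"
    and self: "\<And>A. A \<in> F \<Longrightarrow> centralizer G A \<subseteq> A"
  shows "\<Inter> F = centralizer G (generate G (\<Union> F))"
    and "center (G\<lparr>carrier := generate G (\<Union> F)\<rparr>) = centralizer G (generate G (\<Union> F))"
proof -
  have sub: "A \<subseteq> carrier G" "A \<subseteq> centralizer G A" if "A \<in> F" for A
    using F(1) that abelian_subgroups_subset abelian_subgroups_iff by blast+
  then have U: "\<Union> F \<subseteq> carrier G" by blast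
  \<comment> \<open>Abelian and self-centralizing together mean that each member equals its
    centralizer.\<close>
  have "\<Inter> F = (\<Inter>A\<in>F. centralizer G A)"
    using self sub by blast
  \<comment> \<open>Nonemptiness matters: the empty intersection is the whole type, while the
    centralizer of the empty set is \<open>carrier G\<close>.\<close>
  also have "\<dots> = centralizer G (\<Union> F)"
    using F(2) by (auto simp: centralizer_def)
  finally show I: "\<Inter> F = centralizer G (generate G (\<Union> F))"
    by (simp add: centralizer_generate[OF U])
  \<comment> \<open>The intersection lies in any one member of \<open>F\<close>, hence in the
    generated subgroup.\<close>
  have "\<Inter> F \<subseteq> generate G (\<Union> F)"
    using F(2) by (blast intro: generate.incl)
  then show "center (G\<lparr>carrier := generate G (\<Union> F)\<rparr>) = centralizer G (generate G (\<Union> F))"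
    using center_subgroup_eq[OF generate_incl[OF U]] I by blast
qed

lemma finite_abelian_subgroups:
  "finite (carrier G) \<Longrightarrow> finite (abelian_subgroups G)"
  by (rule finite_subset[of _ "Pow (carrier G)"])
    (use abelian_subgroups_subset in auto)

lemma abelian_subgroups_nonempty: "abelian_subgroups G \<noteq> {}"
proof -
  have "{\<one>} \<in> abelian_subgroups G"
    using triv_subgroup by (auto simp: abelian_subgroups_iff centralizer_def)
  then show ?thesis by blast
qed

section \<open>Element orders and omega inside subgroups\<close>

lemma ord_subgroup:
  assumes "subgroup H G" "x \<in> H"
  shows "group.ord (G\<lparr>carrier := H\<rparr>) x = ord x"
proof -
  \<comment> \<open>An order is determined by the exponents that kill the element, and powers agree
    in \<open>H\<close> and \<open>G\<close>.\<close>
  have "group.ord (G\<lparr>carrier := H\<rparr>) x dvd k \<longleftrightarrow> x [^] k = \<one>" for k :: nat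
    using group.pow_eq_id[OF subgroup_imp_group[OF assms(1)], of x k] assms(2)
    by (simp add: nat_pow_consistent[symmetric])
  then show ?thesis
    using pow_eq_id[OF subgroup.mem_carrier[OF assms]] by (metis dvd_antisym dvd_refl)
qed

lemma Omega_sub_subgroup:
  assumes "subgroup H G"
  shows "Omega_sub p i (G\<lparr>carrier := H\<rparr>) = generate G {x \<in> H. ord x \<le> p ^ i}"
proof -
  have "{x \<in> carrier (G\<lparr>carrier := H\<rparr>). group.ord (G\<lparr>carrier := H\<rparr>) x \<le> p ^ i}
      = {x \<in> H. ord x \<le> p ^ i}"
    using ord_subgroup[OF assms] by auto
  then show ?thesis
    unfolding Omega_sub_def by (simp add: generate_consistent[OF _ assms])
qed

lemma omega_mono:
  assumes "finite (carrier G)" "subgroup A G" "subgroup B G" "A \<subseteq> B"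
  shows "omega p i (G\<lparr>carrier := A\<rparr>) \<le> omega p i (G\<lparr>carrier := B\<rparr>)"
  unfolding omega_def Omega_sub_subgroup[OF assms(2)] Omega_sub_subgroup[OF assms(3)]
proof (rule card_mono)
  have "{x \<in> B. ord x \<le> p ^ i} \<subseteq> carrier G" using subgroup.subset[OF assms(3)] by auto
  from generate_incl[OF this]
  show "finite (generate G {x \<in> B. ord x \<le> p ^ i})"
    using assms(1) by (rule finite_subset)
  show "generate G {x \<in> A. ord x \<le> p ^ i} \<subseteq> generate G {x \<in> B. ord x \<le> p ^ i}"
    using assms(4) by (intro mono_generate) auto
qed

text \<open>Lets the group order be read off from the omega sequence at a late enough index.\<close>

lemma omega_eq_card:
  assumes "subgroup A G" "\<And>x. x \<in> A \<Longrightarrow> ord x \<le> p ^ i"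
  shows "omega p i (G\<lparr>carrier := A\<rparr>) = card A"
proof -
  have "{x \<in> A. ord x \<le> p ^ i} = A" using assms(2) by auto
  moreover have "generate G A = A"
    using generateI[OF assms(1), of A] by auto
  ultimately show ?thesis
    by (simp add: omega_def Omega_sub_subgroup[OF assms(1)])
qed

section \<open>Maximal abelian subgroups: self-centralization and existence\<close>

lemma A_lex_self_centralizing:
  assumes fin: "finite (carrier G)" and ord: "order G = p ^ n" and "p \<ge> 1"
    and A: "A \<in> A_lex p G"
  shows "centralizer G A \<subseteq> A"
proof (rule maximal_abelian_self_centralizing)
  show "A \<in> abelian_subgroups G" using A by (simp add: A_lex_def)
next
  fix B assume B: "B \<in> abelian_subgroups G" "A \<subseteq> B"
  have sub: "subgroup A G" "subgroup B G"
    using A B by (auto simp: A_lex_def abelian_subgroups_def)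
  \<comment> \<open>The bound \<open>p ^ n\<close> is weakened because \<open>lex_ge\<close> only
    sees indices of the form \<open>Suc i\<close>, and \<open>n\<close> may be 0.\<close>
  have le: "ord x \<le> p ^ Suc n" if "x \<in> carrier G" for x
  proof -
    have "ord x \<le> p ^ n" using ord_le_group_order[OF fin that] ord by simp
    also have "\<dots> \<le> p ^ Suc n" using \<open>p \<ge> 1\<close> by (intro power_increasing) auto
    finally show ?thesis .
  qed
  have "lex_ge p (G\<lparr>carrier := A\<rparr>) (G\<lparr>carrier := B\<rparr>)"
    using A B by (simp add: A_lex_def)
  then have "omega p (Suc n) (G\<lparr>carrier := A\<rparr>) = omega p (Suc n) (G\<lparr>carrier := B\<rparr>)"
    using omega_mono[OF fin sub B(2)] by (rule lex_ge_dominated_imp_eq)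
  then have "card A = card B"
    using omega_eq_card le sub subgroup.mem_carrier by metis
  then show "B = A"
    using card_subset_eq[OF _ B(2)] fin finite_subset subgroup.subset[OF sub(2)] by metis
qed

lemma A_o_self_centralizing:
  assumes "finite (carrier G)" "A \<in> A_o G"
  shows "centralizer G A \<subseteq> A"
proof (rule maximal_abelian_self_centralizing)
  show "A \<in> abelian_subgroups G" using assms by (simp add: A_o_def)
next
  fix B assume B: "B \<in> abelian_subgroups G" "A \<subseteq> B"
  have "finite B"
    using B assms(1) abelian_subgroups_subset finite_subset by blast
  then show "B = A"
    using B assms(2) card_seteq[of B A] by (auto simp: A_o_def)
qed

lemma A_lex_nonempty:
  assumes "finite (carrier G)"
  shows "A_lex p G \<noteq> {}"
  using ex_lex_maximal[OF finite_abelian_subgroups[OF assms] abelian_subgroups_nonempty,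
      of p "\<lambda>A. G\<lparr>carrier := A\<rparr>"]
  unfolding A_lex_def by blast

lemma A_o_nonempty:
  assumes "finite (carrier G)"
  shows "A_o G \<noteq> {}"
proof -
  have "Max (card ` abelian_subgroups G) \<in> card ` abelian_subgroups G"
    using finite_abelian_subgroups[OF assms] abelian_subgroups_nonempty by (intro Max_in) auto
  then obtain A where "A \<in> abelian_subgroups G" "card A = Max (card ` abelian_subgroups G)"
    by auto
  then have "A \<in> A_o G"
    using finite_abelian_subgroups[OF assms] by (auto simp: A_o_def)
  then show ?thesis by blast
qed

lemma A_olex_nonempty:
  assumes "finite (carrier G)"
  shows "A_olex p G \<noteq> {}"
proof -
  have "finite (A_o G)"
    using finite_abelian_subgroups[OF assms] by (simp add: A_o_def)
  then show ?thesis
    using ex_lex_maximal[OF _ A_o_nonempty[OF assms], of p "\<lambda>A. G\<lparr>carrier := A\<rparr>"]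
    unfolding A_olex_def by blast
qed

section \<open>Generator numbers and p-torsion of abelian p-groups\<close>

lemma subgroup_nat_pow_closed:
  assumes "subgroup H G" "h \<in> H"
  shows "h [^] (k :: nat) \<in> H"
  by (induction k) (simp_all add: assms subgroup.one_closed subgroup.m_closed)

lemma generate_insert_generate:
  assumes "insert x U \<subseteq> carrier G"
  shows "generate G (insert x (generate G U)) = generate G (insert x U)"
proof
  have "generate G U \<subseteq> generate G (insert x U)" by (rule mono_generate) auto
  then show "generate G (insert x (generate G U)) \<subseteq> generate G (insert x U)"
    by (intro generate_subgroup_incl[OF _ generate_is_subgroup[OF assms]])
      (auto intro: generate.incl)
  show "generate G (insert x U) \<subseteq> generate G (insert x (generate G U))"
    by (intro mono_generate) (auto intro: generate.incl)
qed

end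

context comm_group
begin

lemma pow_group_hom: "group_hom G G (\<lambda>x. x [^] (p::nat))"
  by (unfold_locales) (auto simp: hom_def nat_pow_distrib)

abbreviation powers :: "nat \<Rightarrow> 'a set" where
  "powers p \<equiv> (\<lambda>x. x [^] p) ` carrier G"

text \<open>First isomorphism theorem for the p-th power endomorphism, combined with
  Lagrange.\<close>

lemma card_torsion_mult_powers:
  "card (powers p) * card {x \<in> carrier G. x [^] p = \<one>} = order G"
proof -
  let ?h = "\<lambda>x. x [^] p"
  interpret h: group_hom G G ?h by (rule pow_group_hom)
  \<comment> \<open>Restricting the codomain to the image makes the map surjective.\<close>
  interpret k: group_hom G "G\<lparr>carrier := powers p\<rparr>" ?h
    using h.induced_group_hom[OF subgroup_self] by simp
  let ?K = "kernel G (G\<lparr>carrier := powers p\<rparr>) ?h"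
  have K: "?K = {x \<in> carrier G. x [^] p = \<one>}" by (simp add: kernel_def)
  have "(\<lambda>U. the_elem (?h ` U)) \<in> iso (G Mod ?K) (G\<lparr>carrier := powers p\<rparr>)"
    by (rule k.FactGroup_iso_set) simp
  then have "card (rcosets ?K) = card (powers p)"
    by (auto simp: iso_def FactGroup_def dest: bij_betw_same_card)
  then show ?thesis using lagrange[OF k.subgroup_kernel] K by simp
qed

lemma generate_insert_subset:
  assumes K: "subgroup K G" and x: "x \<in> carrier G" "x [^] p \<in> K" and p: "p > (0::nat)"
  shows "generate G (insert x K) \<subseteq> (\<lambda>(i, k). x [^] i \<otimes> k) ` ({..<p} \<times> K)"
proof -
  interpret K: subgroup K G by (rule K)
  \<comment> \<open>Unbounded exponents make closure under products immediate; they are reduced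
    below \<open>p\<close> only at the end.\<close>
  define E where "E = {x [^] (i::nat) \<otimes> k | i k. k \<in> K}"
  have xk: "x [^] (p * i) \<in> K" for i
  proof -
    have "(x [^] p) [^] i \<in> K" 
      using K x(2) by (rule subgroup_nat_pow_closed)
    then show ?thesis using x by (simp add: nat_pow_pow)
  qed
  have "subgroup E G"
  proof (rule subgroupI)
    show "E \<subseteq> carrier G" using x by (auto simp: E_def)
    show "E \<noteq> {}" unfolding E_def using K.one_closed by blast
  next
    fix a assume "a \<in> E"
    then obtain i k where a: "a = x [^] (i::nat) \<otimes> k" "k \<in> K" by (auto simp: E_def)
    \<comment> \<open>To avoid negative exponents, the inverse of x^i is written as x^(i(p-1)) times
      the inverse of x^(pi), which lies in \<open>K\<close>.\<close>
    let ?b = "x [^] (i * (p - 1)) \<otimes> (inv (x [^] (p * i)) \<otimes> inv k)"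
    have pi: "x [^] (p * i) = x [^] (i * (p - 1)) \<otimes> x [^] i"
      using x p by (cases p) (simp_all add: nat_pow_mult algebra_simps)
    have shuffle: "s \<otimes> (t \<otimes> u) \<otimes> (v \<otimes> w) = s \<otimes> v \<otimes> t \<otimes> (u \<otimes> w)"
      if "s \<in> carrier G" "t \<in> carrier G" "u \<in> carrier G" "v \<in> carrier G" "w \<in> carrier G"
      for s t u v w
      using that by (simp add: m_ac)
    have "inv a = ?b"
    proof (rule inv_equality)
      have "?b \<otimes> a = (x [^] (i * (p - 1)) \<otimes> x [^] i) \<otimes> inv (x [^] (p * i)) \<otimes> (inv k \<otimes> k)"
        unfolding a by (rule shuffle) (use x a(2) in auto)
      also have "\<dots> = \<one>" unfolding pi[symmetric] using x a(2) by simp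
      finally show "?b \<otimes> a = \<one>" .
    qed (use x a in auto)
    moreover have "?b \<in> E" unfolding E_def using xk a(2) by blast
    ultimately show "inv a \<in> E" by simp
  next
    fix a b assume "a \<in> E" "b \<in> E"
    then obtain i k j l where ab: "a = x [^] (i::nat) \<otimes> k" "b = x [^] (j::nat) \<otimes> l" "k \<in> K" "l \<in> K"
      by (auto simp: E_def)
    then have "a \<otimes> b = x [^] i \<otimes> x [^] j \<otimes> (k \<otimes> l)" using x by (simp add: m_ac)
    also have "\<dots> = x [^] (i + j) \<otimes> (k \<otimes> l)" using x by (simp add: nat_pow_mult)
    finally show "a \<otimes> b \<in> E" unfolding E_def using ab by blast
  qed
  moreover have "insert x K \<subseteq> E"
  proof -
    have E: "x [^] (i::nat) \<otimes> k \<in> E" if "k \<in> K" for i k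
      using that unfolding E_def by blast
    have "x \<in> E" using E[OF K.one_closed, of 1] x by simp
    moreover have "k \<in> E" if "k \<in> K" for k using E[OF that, of 0] that by simp
    ultimately show ?thesis by blast
  qed
  ultimately have "generate G (insert x K) \<subseteq> E" by (intro generate_subgroup_incl)
  also have "E \<subseteq> (\<lambda>(i, k). x [^] i \<otimes> k) ` ({..<p} \<times> K)"
  proof
    fix a assume "a \<in> E"
    then obtain i k where a: "a = x [^] (i::nat) \<otimes> k" "k \<in> K" by (auto simp: E_def)
    \<comment> \<open>Division with remainder: the multiple of \<open>p\<close> in the exponent is
      absorbed into \<open>K\<close>.\<close>
    have "x [^] i = x [^] (i mod p) \<otimes> x [^] (p * (i div p))"
      using x by (simp add: nat_pow_mult)
    then have "a = x [^] (i mod p) \<otimes> (x [^] (p * (i div p)) \<otimes> k)"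
      using x a by (simp add: m_assoc)
    moreover have "x [^] (p * (i div p)) \<otimes> k \<in> K" using xk a by simp
    ultimately show "a \<in> (\<lambda>(i, k). x [^] i \<otimes> k) ` ({..<p} \<times> K)"
      using p by (intro image_eqI[of _ _ "(i mod p, x [^] (p * (i div p)) \<otimes> k)"]) auto
  qed
  finally show ?thesis .
qed

lemma card_generate_insert_le:
  assumes "finite (carrier G)" "subgroup K G" "x \<in> carrier G" "x [^] p \<in> K" "p > (0::nat)"
  shows "card (generate G (insert x K)) \<le> p * card K"
proof -
  have fin: "finite ({..<p} \<times> K)"
    using assms(1) subgroup.subset[OF assms(2)] by (auto intro: finite_subset)
  have "card (generate G (insert x K)) \<le> card ((\<lambda>(i, k). x [^] i \<otimes> k) ` ({..<p} \<times> K))"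
    using generate_insert_subset[OF assms(2-5)] fin by (intro card_mono) auto
  also have "\<dots> \<le> card ({..<p} \<times> K)" by (rule card_image_le[OF fin])
  finally show ?thesis by (simp add: card_cartesian_product)
qed

text \<open>As \<open>H\<close> contains all p-th powers, each further generator multiplies the
  order by at most \<open>p\<close>.\<close>

lemma card_generate_Un_le:
  assumes "finite (carrier G)" "subgroup H G" "powers p \<subseteq> H" "p > 0"
    and "finite B" "B \<subseteq> carrier G"
  shows "card (generate G (H \<union> B)) \<le> card H * p ^ card B"
  using assms(5,6)
proof (induction B rule: finite_induct)
  case empty
  then show ?case using generateI[OF assms(2), of H] by auto
next
  case (insert x B)
  have H: "H \<subseteq> carrier G" using assms(2) by (rule subgroup.subset)
  have "generate G (H \<union> insert x B) = generate G (insert x (generate G (H \<union> B)))"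
    using insert.prems H by (subst generate_insert_generate) auto
  also have "card \<dots> \<le> p * card (generate G (H \<union> B))"
    using insert.prems H assms(1,3,4)
    by (intro card_generate_insert_le generate_is_subgroup) (auto intro: generate.incl)
  also have "\<dots> \<le> p * (card H * p ^ card B)"
    using insert by auto
  finally show ?case using insert.hyps by (simp add: mult_ac)
qed

lemma p_group_card_subgroup_jump:
  assumes "Factorial_Ring.prime p" "order G = p ^ n" "subgroup H G" "subgroup K G" "H \<subset> K"
  shows "card H * p \<le> card K"
proof -
  have p: "p > 1" using assms(1) prime_gt_1_nat by blast
  then have "finite (carrier G)" using assms(2) order_gt_0_iff_finite by simp
  then have "finite K" using subgroup.subset[OF assms(4)] finite_subset by blast
  then have lt: "card H < card K" using assms(5) by (rule psubset_card_mono)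
  \<comment> \<open>By Lagrange both orders are powers of \<open>p\<close>, so strict growth is
    growth by a factor of at least \<open>p\<close>.\<close>
  have "\<exists>i. card M = p ^ i" if "subgroup M G" for M
    using lagrange[OF that] assms(1,2) by (metis divides_primepow_nat dvd_triv_right)
  then obtain i j where ij: "card H = p ^ i" "card K = p ^ j" using assms(3,4) by metis
  then have "Suc i \<le> j" using lt p by (simp add: power_strict_increasing_iff)
  then have "p ^ Suc i \<le> p ^ j" using p by (intro power_increasing) auto
  then show ?thesis using ij by (simp add: mult.commute)
qed

text \<open>Greedy choice: adjoining any element outside the current subgroup multiplies its order
  by at least \<open>p\<close>, which bounds the number of elements chosen.\<close>

lemma ex_relative_generators:
  assumes "Factorial_Ring.prime p" "order G = p ^ n" "subgroup H G"
  shows "\<exists>B. finite B \<and> B \<subseteq> carrier G \<and> generate G (H \<union> B) = carrier G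
           \<and> card H * p ^ card B \<le> order G"
  using assms(3)
proof (induction "order G - card H" arbitrary: H rule: less_induct)
  case less
  have p: "p > 1" using assms(1) prime_gt_1_nat by blast
  then have fin: "finite (carrier G)" using assms(2) order_gt_0_iff_finite by simp
  have H: "H \<subseteq> carrier G" using less.prems by (rule subgroup.subset)
  show ?case
  proof (cases "H = carrier G")
    case True
    then have "generate G H = carrier G"
      using generateI[OF subgroup_self, of H] by auto
    then show ?thesis using True by (intro exI[of _ "{}"]) (simp add: order_def)
  next
    case False
    then obtain x where x: "x \<in> carrier G" "x \<notin> H" using H by blast
    let ?K = "generate G (insert x H)"
    have sub: "insert x H \<subseteq> carrier G" using x H by simp
    have K: "subgroup ?K G" by (rule generate_is_subgroup[OF sub])
    have "H \<subset> ?K" using x by (auto intro: generate.incl)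
    then have jump: "card H * p \<le> card ?K" "card H < card ?K"
      using p_group_card_subgroup_jump[OF assms(1,2) less.prems K]
        psubset_card_mono finite_subset[OF subgroup.subset[OF K] fin] by auto
    have "card ?K \<le> order G"
      unfolding order_def using subgroup.subset[OF K] fin by (rule card_mono[rotated])
    then obtain B where B: "finite B" "B \<subseteq> carrier G" "generate G (?K \<union> B) = carrier G"
        "card ?K * p ^ card B \<le> order G"
      using less.hyps[OF _ K] jump(2) by (meson diff_less_mono2 less_le_trans)
    have "?K \<subseteq> generate G (H \<union> insert x B)"
      by (rule mono_generate) auto
    then have "generate G (?K \<union> B) \<subseteq> generate G (H \<union> insert x B)"
      using B(2) x H by (intro generate_subgroup_incl generate_is_subgroup) (auto intro: generate.incl)
    then have "generate G (H \<union> insert x B) = carrier G"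
      using B x H generate_incl[of "H \<union> insert x B"] by auto
    moreover have "card H * p ^ card (insert x B) \<le> order G"
    proof -
      \<comment> \<open>An inequality suffices, so it need not be checked whether \<open>x\<close>
        already lies in \<open>B\<close>.\<close>
      have "p ^ card (insert x B) \<le> p ^ Suc (card B)"
        using p B(1) by (intro power_increasing) (auto simp: card_insert_if)
      then have "card H * p ^ card (insert x B) \<le> card H * p * p ^ card B"
        by (simp add: mult.assoc)
      also have "\<dots> \<le> card ?K * p ^ card B" using jump(1) by simp
      finally show ?thesis using B(4) by simp
    qed
    ultimately show ?thesis using B x by (intro exI[of _ "insert x B"]) auto
  qed
qed

text \<open>In a commutative group the product of two subgroups is a subgroup, and here it contains
  \<open>H\<close> and \<open>B\<close>.\<close>

lemma generate_Un_subgroup_subset: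
  assumes "subgroup H G" "B \<subseteq> carrier G"
  shows "generate G (H \<union> B) \<subseteq> H <#> generate G B"
proof (rule generate_subgroup_incl)
  have M: "subgroup (generate G B) G" by (rule generate_is_subgroup[OF assms(2)])
  then show "subgroup (H <#> generate G B) G" using mult_subgroups assms(1) by blast
  have "h \<otimes> \<one> \<in> H <#> generate G B" if "h \<in> H" for h
    using that M by (auto simp: set_mult_def intro: subgroup.one_closed)
  moreover have "\<one> \<otimes> b \<in> H <#> generate G B" if "b \<in> B" for b
    using that assms(1) subgroup.one_closed generate.incl by (fastforce simp: set_mult_def)
  moreover have "h \<otimes> \<one> = h" if "h \<in> H" for h
    using subgroup.mem_carrier[OF assms(1) that] by simp
  moreover have "\<one> \<otimes> b = b" if "b \<in> B" for b
    using assms(2) that by auto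
  ultimately show "H \<union> B \<subseteq> H <#> generate G B" by auto
qed

lemma generate_eq_carrier_if_mod_powers:
  assumes ord: "order G = p ^ n" and B: "B \<subseteq> carrier G"
    and gen: "generate G (powers p \<union> B) = carrier G"
  shows "generate G B = carrier G"
proof
  let ?M = "generate G B"
  show "?M \<subseteq> carrier G" by (rule generate_incl[OF B])
  interpret M: subgroup ?M G by (rule generate_is_subgroup[OF B])
  have P: "subgroup (powers p) G"
    using group_hom.img_is_subgroup[OF pow_group_hom] .
  \<comment> \<open>Nakayama-style: iterate \<open>G = M G\<^sup>p\<close>, which ends since the \<open>p ^ n\<close>-th powers are trivial.\<close>
  have step: "\<exists>m\<in>?M. \<exists>y\<in>carrier G. x = m \<otimes> y [^] (p ^ k)" if "x \<in> carrier G" for x k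
    using that
  proof (induction k)
    case 0
    then show ?case by (intro bexI[of _ \<one>] bexI[of _ x]) auto
  next
    case (Suc k)
    then obtain m y where my: "m \<in> ?M" "y \<in> carrier G" "x = m \<otimes> y [^] (p ^ k)" by blast
    then obtain z m' where z: "z \<in> carrier G" "m' \<in> ?M" "y = z [^] p \<otimes> m'"
      using generate_Un_subgroup_subset[OF P B] gen by (auto simp: set_mult_def)
    have "y [^] (p ^ k) = z [^] (p ^ Suc k) \<otimes> m' [^] (p ^ k)"
      using z by (simp add: nat_pow_distrib nat_pow_pow)
    then have "x = (m \<otimes> m' [^] (p ^ k)) \<otimes> z [^] (p ^ Suc k)"
      using my z by (simp add: m_ac)
    moreover have "m' [^] (p ^ k) \<in> ?M"
      using M.is_subgroup z(2) by (rule subgroup_nat_pow_closed)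
    ultimately show ?case using my z by blast
  qed
  show "carrier G \<subseteq> ?M"
  proof
    fix x assume "x \<in> carrier G"
    then obtain m y where "m \<in> ?M" "y \<in> carrier G" "x = m \<otimes> y [^] (p ^ n)"
      using step by blast
    then show "x \<in> ?M" using pow_order_eq_1[of y] ord by simp
  qed
qed

lemma p_group_card_torsion:
  assumes "Factorial_Ring.prime p" "order G = p ^ n"
  shows "card {x \<in> carrier G. x [^] p = \<one>} = p ^ min_generators G"
proof -
  let ?T = "{x \<in> carrier G. x [^] p = \<one>}"
  have p: "p > 1" using assms(1) prime_gt_1_nat by blast
  then have fin: "finite (carrier G)" using assms(2) order_gt_0_iff_finite by simp
  have P: "subgroup (powers p) G"
    using group_hom.img_is_subgroup[OF pow_group_hom] .
  have Ppos: "card (powers p) > 0" using P fin subgroup.finite_imp_card_positive by blast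
  have ord: "card (powers p) * card ?T = order G" by (rule card_torsion_mult_powers)
  let ?gen = "\<lambda>k. \<exists>B. B \<subseteq> carrier G \<and> finite B \<and> card B = k \<and> generate G B = carrier G"
  have "generate G (carrier G) = carrier G"
    using generateI[OF subgroup_self, of "carrier G"] by auto
  \<comment> \<open>The whole carrier is a generating set, so the \<open>LEAST\<close> in
    \<open>min_generators\<close> is attained.\<close>
  then have "?gen (order G)" using fin by (auto simp: order_def)
  then have "?gen (min_generators G)" unfolding min_generators_def by (rule LeastI)
  then obtain B where B: "B \<subseteq> carrier G" "finite B" "card B = min_generators G"
      "generate G B = carrier G"
    by blast
  have "generate G (powers p \<union> B) = carrier G"
    using mono_generate[of B "powers p \<union> B"] generate_incl[of "powers p \<union> B"] B(1,4) by auto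
  \<comment> \<open>A minimal generating set bounds the index of \<open>powers p\<close> from above;
    that index is \<open>card ?T\<close>.\<close>
  then have "order G \<le> card (powers p) * p ^ min_generators G"
    using card_generate_Un_le[OF fin P _ _ B(2,1)] p B(3) by (simp add: order_def)
  then have 1: "card ?T \<le> p ^ min_generators G"
    using Ppos unfolding ord[symmetric] by simp
  \<comment> \<open>Conversely, few elements generate modulo \<open>powers p\<close>, and these
    already generate \<open>G\<close>.\<close>
  obtain C where C: "finite C" "C \<subseteq> carrier G" "generate G (powers p \<union> C) = carrier G"
      "card (powers p) * p ^ card C \<le> order G"
    using ex_relative_generators[OF assms P] by blast
  then have "?gen (card C)" using generate_eq_carrier_if_mod_powers[OF assms(2)] by blast
  then have "min_generators G \<le> card C" unfolding min_generators_def by (rule Least_le)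
  then have "p ^ min_generators G \<le> p ^ card C" using p by (intro power_increasing) auto
  also have "\<dots> \<le> card ?T" using C(4) Ppos unfolding ord[symmetric] by simp
  finally show ?thesis using 1 by simp
qed

lemma p_group_omega1:
  assumes "Factorial_Ring.prime p" "order G = p ^ n"
  shows "omega p 1 G = p ^ min_generators G"
proof -
  let ?T = "{x \<in> carrier G. x [^] p = \<one>}"
  have p: "p > 1" using assms(1) prime_gt_1_nat by blast
  have "ord x \<le> p \<longleftrightarrow> x [^] p = \<one>" if x: "x \<in> carrier G" for x
  proof
    assume le: "ord x \<le> p"
    obtain i where i: "ord x = p ^ i"
      using ord_dvd_group_order[OF x] assms by (metis divides_primepow_nat)
    \<comment> \<open>Orders are powers of \<open>p\<close>, so being at most \<open>p\<close> is
      the same as dividing \<open>p\<close>.\<close>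
    then have "i \<le> 1" using le p by (metis power_increasing_iff power_one_right)
    then have "ord x dvd p" using i by (metis le_imp_power_dvd power_one_right)
    then show "x [^] p = \<one>" using pow_eq_id[OF x] by simp
  next
    assume "x [^] p = \<one>"
    then show "ord x \<le> p" using pow_eq_id[OF x] p dvd_imp_le by simp
  qed
  then have "{x \<in> carrier G. ord x \<le> p ^ 1} = ?T" by auto
  \<comment> \<open>As the kernel of the p-th power map, the torsion set is a subgroup, so
    \<open>generate\<close> adds nothing.\<close>
  moreover have "subgroup ?T G"
    using group_hom.subgroup_kernel[OF pow_group_hom, of p] by (simp add: kernel_def)
  then have "generate G ?T = ?T" using generateI[of ?T ?T] by auto
  ultimately show ?thesis
    using p_group_card_torsion[OF assms] by (simp add: omega_def Omega_sub_def)
qed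

end

section \<open>Maximal rank of lexicographically maximal subgroups, and the conclusion\<close>

lemma (in group) A_lex_subset_A_r:
  assumes p: "Factorial_Ring.prime p" and fin: "finite (carrier G)" and ord: "order G = p ^ n"
  shows "A_lex p G \<subseteq> A_r G"
proof
  fix A assume A: "A \<in> A_lex p G"
  then have ab: "A \<in> abelian_subgroups G" by (simp add: A_lex_def)
  let ?d = "\<lambda>B. min_generators (G\<lparr>carrier := B\<rparr>)"
  have p1: "p > 1" using p prime_gt_1_nat by blast
  have omega: "omega p 1 (G\<lparr>carrier := B\<rparr>) = p ^ ?d B" if "B \<in> abelian_subgroups G" for B
  proof -
    have "card B dvd p ^ n"
      using that lagrange[of B] ord unfolding abelian_subgroups_iff by (metis dvd_triv_right)
    then obtain m where "order (G\<lparr>carrier := B\<rparr>) = p ^ m"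
      using p by (auto simp: order_def divides_primepow_nat)
    then show ?thesis
      using that comm_group.p_group_omega1[OF _ p] by (auto simp: abelian_subgroups_def)
  qed
  have max: "?d B \<le> ?d A" if B: "B \<in> abelian_subgroups G" for B
  proof -
    have "omega p 1 (G\<lparr>carrier := B\<rparr>) \<le> omega p 1 (G\<lparr>carrier := A\<rparr>)"
      using A B by (intro lex_ge_omega1) (simp add: A_lex_def)
    then show ?thesis using omega[OF B] omega[OF ab] p1 by simp
  qed
  have "group_rank (G\<lparr>carrier := A\<rparr>) = ?d A"
    using ab by (simp add: group_rank_def abelian_subgroups_def)
  also have "\<dots> = group_rank G"
  \<comment> \<open>The cases follow \<open>group_rank\<close>. For commutative \<open>G\<close> the
    rank is no maximum over subgroups, but a self-centralizing \<open>A\<close> is then all of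
    \<open>G\<close>.\<close>
  proof (cases "comm_group G")
    case True
    then have "centralizer G A = carrier G"
      using abelian_subgroups_subset[OF ab]
      by (auto simp: centralizer_def intro!: comm_groupE(4)[OF True])
    then have "A = carrier G"
      using A_lex_self_centralizing[OF fin ord _ A] p1 abelian_subgroups_subset[OF ab] by auto
    then show ?thesis using True by (simp add: group_rank_def)
  next
    case False
    have "Max (?d ` abelian_subgroups G) = ?d A"
      using max ab finite_abelian_subgroups[OF fin] by (intro Max_eqI) auto
    then show ?thesis using False by (simp add: group_rank_def)
  qed
  finally show "A \<in> A_r G" using ab by (simp add: A_r_def)
qed

theorem mainTheorem9:
  fixes S :: "('a, 'b) monoid_scheme" and p n :: nat
  assumes "Factorial_Ring.prime p"
    and "group S"
    and "finite (carrier S)"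
    and "order S = p ^ n"
  shows "(I_lex p S = center (S\<lparr>carrier := J_lex p S\<rparr>)
          \<and> center (S\<lparr>carrier := J_lex p S\<rparr>) = centralizer S (J_lex p S)
          \<and> centralizer S (J_lex p S) \<supseteq> center (S\<lparr>carrier := J_r S\<rparr>))
       \<and> (I_olex p S = center (S\<lparr>carrier := J_olex p S\<rparr>)
          \<and> center (S\<lparr>carrier := J_olex p S\<rparr>) = centralizer S (J_olex p S)
          \<and> centralizer S (J_olex p S) \<supseteq> center (S\<lparr>carrier := J_o S\<rparr>))"
proof -
  interpret group S by (rule assms(2))
  have lex: "A_lex p S \<subseteq> abelian_subgroups S" "A_lex p S \<noteq> {}"
    using A_lex_nonempty[OF assms(3)] by (auto simp: A_lex_def)
  have "p \<ge> 1" using assms(1) prime_ge_1_nat by blast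
  note lex_eq = Inter_self_centralizing_family[OF lex A_lex_self_centralizing[OF assms(3,4) this]]
  have olex: "A_olex p S \<subseteq> abelian_subgroups S" "A_olex p S \<noteq> {}"
    using A_olex_nonempty[OF assms(3)] by (auto simp: A_olex_def A_o_def)
  have olex_o: "A_olex p S \<subseteq> A_o S" by (auto simp: A_olex_def)
  \<comment> \<open>Members of \<open>A_olex p S\<close> have the largest order among abelian
    subgroups, which already makes them self-centralizing.\<close>
  have olex_self: "centralizer S A \<subseteq> A" if "A \<in> A_olex p S" for A
    using A_o_self_centralizing[OF assms(3)] that olex_o by blast
  note olex_eq = Inter_self_centralizing_family[OF olex olex_self]
  have carr: "J_r S \<subseteq> carrier S" "J_o S \<subseteq> carrier S"
    unfolding J_r_def J_o_def
    by (intro generate_incl; use abelian_subgroups_subset in \<open>auto simp: A_r_def A_o_def\<close>)+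
  \<comment> \<open>Inclusions of families pass to the generated subgroups, and the center of the
    larger one centralizes the smaller.\<close>
  have "J_lex p S \<subseteq> J_r S" "J_olex p S \<subseteq> J_o S"
    unfolding J_lex_def J_r_def J_olex_def J_o_def
    using A_lex_subset_A_r[OF assms(1,3,4)] olex_o by (intro mono_generate Union_mono; blast)+
  then have "center (S\<lparr>carrier := J_r S\<rparr>) \<subseteq> centralizer S (J_lex p S)"
      "center (S\<lparr>carrier := J_o S\<rparr>) \<subseteq> centralizer S (J_olex p S)"
    using center_antimono_centralizer carr by blast+
  then show ?thesis
    using lex_eq olex_eq by (simp add: I_lex_def J_lex_def I_olex_def J_olex_def)
qed

end
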